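(* Let $X_0\subset X\subseteq\mathbb{R}^n$, $X_u\subset X$ and $T>0$. Suppose that $f$ is continuous ($f\in C^0$) and that the cost $c(x,y)$ is continuous on $X\times X_u$. Further impose that, if $X_0\subset X$ are both compact, then the following non-return condition holds: if $x(t\mid x_0)\in\partial X$ for some $t\in[0,T]$, $x_0\in X_0$, then $x(t'\mid x_0)\notin X$ for all $t'\in(t,T]$. Let $P^*$ be the distance of closest approach of trajectories to $X_u$ (defined in the context). Consider the linear program in the measures $(\mu_0,\mu_p,\mu,\eta)$ $$\begin{aligned} p^*=\inf\ & \langle c(x,y),\eta\rangle\\ \text{s.t. } & \pi^x_\#\eta=\pi^x_\#\mu_p,\\ & \mu_p=\delta_0\otimes\mu_0+\mathcal{L}_f^\dagger\mu,\\ & \langle 1,\mu_0\rangle=1,\\ & \mu_0\in\mathcal{M}_+(X_0),\ \eta\in\mathcal{M}_+(X\times X_u),\ \mu_p,\mu\in\mathcal{M}_+([0,T]\times X).\end{aligned}$$ Then $p^*$ is a lower bound for $P^*$, i.e. $p^*\le P^*$.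
   Context: $X_0\subset X\subseteq\mathbb{R}^n$ (initial set, state set) and $X_u\subset X$ (unsafe set) are Borel sets, $f:[0,T]\times\mathbb{R}^n\to\mathbb{R}^n$ is the vector field. $x(\cdot\mid x_0)$ denotes a trajectory of $\dot x(t)=f(t,x(t))$ with $x(0)=x_0$. The state is restricted to $X$: a pair (trajectory, stopping time $t\in[0,T]$) is admissible if the trajectory starts at some $x_0\in X_0$, exists on $[0,t]$, and satisfies $x(s\mid x_0)\in X$ for all $s\in[0,t]$. The distance of closest approach is $$P^*=\inf\ c(x(t\mid x_0),y),$$ the infimum being over all admissible trajectories and stopping times $t\in[0,T]$ with $x_0\in X_0$, and all $y\in X_u$. $\mathcal{M}_+(S)$ is the set of nonnegative Borel measures on $S$, and $\langle h,\nu\rangle=\int h\,d\nu$. $\pi^x_\#\nu$ denotes the $x$-marginal of $\nu$ (so $\langle w,\pi^x_\#\eta\rangle=\int w(x)\,d\eta(x,y)$ and $\langle w,\pi^x_\#\mu_p\rangle=\int w(x)\,d\mu_p(t,x)$ for $w\in C(X)$). $C^1([0,T]\times X)$ denotes functions continuously differentiable on a neighbourhood of $[0,T]\times X$ and $\mathcal{L}_f v(t,x)=\partial_t v(t,x)+f(t,x)\cdot\nabla_x v(t,x)$. The constraint $\mu_p=\delta_0\otimes\mu_0+\mathcal{L}_f^\dagger\mu$ (Liouville equation) means $$\langle v(t,x),\mu_p\rangle=\langle v(0,x),\mu_0\rangle+\langle\mathcal{L}_f v(t,x),\mu\rangle\quad\text{for all } v\in C^1([0,T]\times X).$$ When the sets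 are not compact, feasible tuples are those for which all the integrals involved are finite. *)

theory Defs
  imports "HOL-Analysis.Analysis"
begin

section \<open>Trajectories and the distance of closest approach\<close>

text \<open>
  \<open>x\<close> is a (classical) solution on \<open>{0..t}\<close>, with one-sided derivatives at the end points;
  values of \<open>x\<close> outside \<open>{0..t}\<close> are irrelevant.  Since \<open>f\<close> is only assumed continuous,
  solutions need not be unique, so a trajectory is a relation and not a function of \<open>x0\<close>.
\<close>

definition trajectory_on ::
    "(real \<Rightarrow> real^'n \<Rightarrow> real^'n) \<Rightarrow> real \<Rightarrow> real^'n \<Rightarrow> (real \<Rightarrow> real^'n) \<Rightarrow> bool" where
  "trajectory_on f t x0 x \<longleftrightarrow>
     x 0 = x0 \<and> (\<forall>s\<in>{0..t}. (x has_vector_derivative f s (x s)) (at s within {0..t}))"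

definition admissible ::
    "real \<Rightarrow> (real \<Rightarrow> real^'n \<Rightarrow> real^'n) \<Rightarrow> (real^'n) set \<Rightarrow> (real^'n) set
      \<Rightarrow> (real \<Rightarrow> real^'n) \<Rightarrow> real \<Rightarrow> bool" where
  "admissible T f X0 X x t \<longleftrightarrow>
     t \<in> {0..T} \<and> (\<exists>x0\<in>X0. trajectory_on f t x0 x) \<and> (\<forall>s\<in>{0..t}. x s \<in> X)"

definition closest_approach ::
    "real \<Rightarrow> (real \<Rightarrow> real^'n \<Rightarrow> real^'n) \<Rightarrow> (real^'n) set \<Rightarrow> (real^'n) set \<Rightarrow> (real^'n) set
      \<Rightarrow> (real^'n \<Rightarrow> real^'n \<Rightarrow> real) \<Rightarrow> ereal" where
  "closest_approach T f X0 X Xu c =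
     Inf {ereal (c (x t) y) | x t y. admissible T f X0 X x t \<and> y \<in> Xu}"

text \<open>
  Trajectories are not confined to \<open>X\<close> here.  The later times \<open>t'\<close> range over the part of
  \<open>{t<..T}\<close> on which the trajectory exists (solutions may blow up before \<open>T\<close>).
\<close>

definition non_return ::
    "real \<Rightarrow> (real \<Rightarrow> real^'n \<Rightarrow> real^'n) \<Rightarrow> (real^'n) set \<Rightarrow> (real^'n) set \<Rightarrow> bool" where
  "non_return T f X0 X \<longleftrightarrow>
     (\<forall>x0\<in>X0. \<forall>\<tau>\<in>{0..T}. \<forall>x. trajectory_on f \<tau> x0 x \<longrightarrow>
        (\<forall>t\<in>{0..\<tau>}. x t \<in> frontier X \<longrightarrow> (\<forall>t'\<in>{t<..\<tau>}. x t' \<notin> X)))"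

section \<open>The measure linear program\<close>

text \<open>Continuously differentiable on some open neighbourhood of \<open>S\<close>.\<close>

definition C1_near :: "'a::real_normed_vector set \<Rightarrow> ('a \<Rightarrow> real) \<Rightarrow> bool" where
  "C1_near S v \<longleftrightarrow>
     (\<exists>U (v' :: 'a \<Rightarrow> 'a \<Rightarrow>\<^sub>L real). open U \<and> S \<subseteq> U \<and>
        (\<forall>z\<in>U. (v has_derivative blinfun_apply (v' z)) (at z)) \<and> continuous_on U v')"

definition gradient :: "(real^'n \<Rightarrow> real) \<Rightarrow> real^'n \<Rightarrow> real^'n" where
  "gradient g x = (THE D. GDERIV g x :> D)"

definition Lie ::
    "(real \<Rightarrow> real^'n \<Rightarrow> real^'n) \<Rightarrow> (real \<times> (real^'n) \<Rightarrow> real) \<Rightarrow> real \<times> (real^'n) \<Rightarrow> real" where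
  "Lie f v = (\<lambda>(t, x). deriv (\<lambda>s. v (s, x)) t + f t x \<bullet> gradient (\<lambda>\<xi>. v (t, \<xi>)) x)"

text \<open>Nonnegative Borel measures on \<open>S\<close>: the underlying space is \<open>S\<close> itself.\<close>

definition borel_measures_on :: "'a::topological_space set \<Rightarrow> 'a measure set" where
  "borel_measures_on S = {\<nu>. sets \<nu> = sets (restrict_space borel S)}"

text \<open>
  The equation \<open>\<mu>p = \<delta>\<^sub>0 \<otimes> \<mu>0 + L\<^sub>f\<^sup>\<dagger> \<mu>\<close> in its weak form.  Integrability is required explicitly
  because the Bochner integral of a non-integrable function is \<open>0\<close> by convention.
\<close>

definition liouville ::
    "real \<Rightarrow> (real \<Rightarrow> real^'n \<Rightarrow> real^'n) \<Rightarrow> (real^'n) set \<Rightarrow> (real^'n) measure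
      \<Rightarrow> (real \<times> (real^'n)) measure \<Rightarrow> (real \<times> (real^'n)) measure \<Rightarrow> bool" where
  "liouville T f X \<mu>0 \<mu>p \<mu> \<longleftrightarrow>
     (\<forall>v. C1_near ({0..T} \<times> X) v \<longrightarrow>
        integrable \<mu>p v \<and> integrable \<mu>0 (\<lambda>x. v (0, x)) \<and> integrable \<mu> (Lie f v) \<and>
        (\<integral>z. v z \<partial>\<mu>p) = (\<integral>x. v (0, x) \<partial>\<mu>0) + (\<integral>z. Lie f v z \<partial>\<mu>))"

definition lp_feasible ::
    "real \<Rightarrow> (real \<Rightarrow> real^'n \<Rightarrow> real^'n) \<Rightarrow> (real^'n) set \<Rightarrow> (real^'n) set \<Rightarrow> (real^'n) set
      \<Rightarrow> (real^'n \<Rightarrow> real^'n \<Rightarrow> real)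
      \<Rightarrow> (real^'n) measure \<Rightarrow> (real \<times> (real^'n)) measure \<Rightarrow> (real \<times> (real^'n)) measure
      \<Rightarrow> ((real^'n) \<times> (real^'n)) measure \<Rightarrow> bool" where
  "lp_feasible T f X0 X Xu c \<mu>0 \<mu>p \<mu> \<eta> \<longleftrightarrow>
     \<mu>0 \<in> borel_measures_on X0 \<and>
     \<eta> \<in> borel_measures_on (X \<times> Xu) \<and>
     \<mu>p \<in> borel_measures_on ({0..T} \<times> X) \<and>
     \<mu> \<in> borel_measures_on ({0..T} \<times> X) \<and>
     distr \<eta> (restrict_space borel X) fst = distr \<mu>p (restrict_space borel X) snd \<and>
     liouville T f X \<mu>0 \<mu>p \<mu> \<and>
     (\<integral>\<^sup>+x. 1 \<partial>\<mu>0) = 1 \<and>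
     integrable \<eta> (\<lambda>(x, y). c x y)"

definition lp_value ::
    "real \<Rightarrow> (real \<Rightarrow> real^'n \<Rightarrow> real^'n) \<Rightarrow> (real^'n) set \<Rightarrow> (real^'n) set \<Rightarrow> (real^'n) set
      \<Rightarrow> (real^'n \<Rightarrow> real^'n \<Rightarrow> real) \<Rightarrow> ereal" where
  "lp_value T f X0 X Xu c =
     Inf {ereal (\<integral>(x, y). c x y \<partial>\<eta>) | \<mu>0 \<mu>p \<mu> \<eta>. lp_feasible T f X0 X Xu c \<mu>0 \<mu>p \<mu> \<eta>}"

end

theory Submission
  imports Defs "HOL-Probability.Giry_Monad"
begin

text \<open>
  An admissible pair \<open>(x, t)\<close> and a point \<open>y \<in> Xu\<close> yield a feasible tuple of the same cost: \<open>\<mu>0\<close>,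
  \<open>\<mu>p\<close> and \<open>\<eta>\<close> are the Dirac measures at \<open>x 0\<close>, \<open>(t, x t)\<close> and \<open>(x t, y)\<close>, and \<open>\<mu>\<close> is the
  occupation measure, the image of Lebesgue measure on \<open>{0..t}\<close> under \<open>s \<mapsto> (s, x s)\<close>.  The
  Liouville equation is then the fundamental theorem of calculus for \<open>s \<mapsto> v (s, x s)\<close>, whose
  derivative is \<open>Lie f v (s, x s)\<close>.
\<close>

text \<open>\<open>gradient\<close> is a definite description, so it says nothing until existence
  and uniqueness are shown. Uniqueness follows from uniqueness of the derivative, since a vector is
  determined by its inner products.\<close>

lemma gradient_inner:
  assumes "(g has_derivative L) (at x)"
  shows "h \<bullet> gradient g x = L h"
proof -
  have lin: "linear L"
    using assms has_derivative_linear by blast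
  \<comment> \<open>Riesz representation of the functional \<open>L\<close>: the adjoint satisfies
    \<open>h \<bullet> adjoint L 1 = L h * 1\<close>.\<close>
  have L: "L = (\<lambda>h. h \<bullet> adjoint L 1)"
    using adjoint_works[OF lin, of _ 1] by auto
  then have "GDERIV g x :> adjoint L 1"
    using assms unfolding gderiv_def by simp
  moreover have "D = adjoint L 1" if "GDERIV g x :> D" for D
    using has_derivative_unique[OF assms that[unfolded gderiv_def]] L
    by (metis vector_eq_ldot)
  ultimately have "gradient g x = adjoint L 1"
    unfolding gradient_def by (rule the_equality)
  then show ?thesis
    using L by metis
qed

text \<open>Composing \<open>v\<close> with \<open>s \<mapsto> (s, x)\<close> and
  \<open>\<xi> \<mapsto> (t, \<xi>)\<close> identifies the two partial terms as
  \<open>L (1, 0)\<close> and \<open>L (0, f t x)\<close>; linearity of \<open>L\<close> adds them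
  up.\<close>

lemma Lie_eq_derivative:
  assumes "(v has_derivative L) (at (t, x))"
  shows "Lie f v (t, x) = L (1, f t x)"
proof -
  have "((\<lambda>s. v (s, x)) has_derivative (\<lambda>h. L (h, 0))) (at t)"
    by (rule has_derivative_compose[where f = "\<lambda>s. (s, x)" and g = v])
       (auto intro!: derivative_eq_intros assms)
  moreover have lin: "linear L"
    using assms has_derivative_linear by blast
  moreover have "(\<lambda>h. L (h, 0)) = (*) (L (1, 0))"
  proof
    show "L (h, 0) = L (1, 0) * h" for h
      using linear_scale[OF lin, of h "(1, 0)"] by (simp add: mult.commute)
  qed
  ultimately have dt: "deriv (\<lambda>s. v (s, x)) t = L (1, 0)"
    by (intro DERIV_imp_deriv) (simp add: has_field_derivative_def)
  have "((\<lambda>\<xi>. v (t, \<xi>)) has_derivative (\<lambda>h. L (0, h))) (at x)"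
    by (rule has_derivative_compose[where f = "\<lambda>\<xi>. (t, \<xi>)" and g = v])
       (auto intro!: derivative_eq_intros assms)
  then have dx: "f t x \<bullet> gradient (\<lambda>\<xi>. v (t, \<xi>)) x = L (0, f t x)"
    by (rule gradient_inner)
  show ?thesis
    using linear_add[OF lin, of "(1, 0)" "(0, f t x)"] by (simp add: Lie_def dt dx)
qed

lemma C1_near_continuous_on:
  assumes "C1_near S v"
  shows "continuous_on S v"
  using assms unfolding C1_near_def
  by (blast intro: continuous_at_imp_continuous_on has_derivative_continuous)

text \<open>On the neighbourhood where \<open>v\<close> is differentiable, \<open>Lie f v\<close> is
  the continuous derivative \<open>v'\<close> applied to the continuous field
  \<open>(1, f)\<close>.\<close>

lemma C1_near_continuous_on_Lie:
  fixes X :: "(real^'n) set"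
  assumes v: "C1_near ({0..T} \<times> X) v"
    and f: "continuous_on ({0..T} \<times> UNIV) (\<lambda>(t, x). f t x)"
  shows "continuous_on ({0..T} \<times> X) (Lie f v)"
proof -
  obtain U and v' :: "real \<times> (real^'n) \<Rightarrow> (real \<times> (real^'n)) \<Rightarrow>\<^sub>L real"
    where U: "{0..T} \<times> X \<subseteq> U" "continuous_on U v'"
      and D: "\<And>z. z \<in> U \<Longrightarrow> (v has_derivative blinfun_apply (v' z)) (at z)"
    using v unfolding C1_near_def by blast
  have f': "continuous_on ({0..T} \<times> X) (\<lambda>z. f (fst z) (snd z))"
    by (rule continuous_on_subset[of "{0..T} \<times> UNIV"]) (use f in \<open>auto simp: case_prod_beta'\<close>)
  have "continuous_on ({0..T} \<times> X) (\<lambda>z. v' z (1, f (fst z) (snd z)))"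
    by (intro continuous_intros f' continuous_on_subset[OF U(2) U(1)])
  moreover have "Lie f v z = v' z (1, f (fst z) (snd z))" if "z \<in> {0..T} \<times> X" for z
    using Lie_eq_derivative[of v _ "fst z" "snd z" f] D U(1) that by auto
  ultimately show ?thesis
    by (simp cong: continuous_on_cong)
qed

text \<open>Chain rule: the curve \<open>s \<mapsto> (s, x s)\<close> has velocity
  \<open>(1, f s (x s))\<close>. As \<open>v\<close> is differentiable on a neighbourhood of
  \<open>S\<close>, boundary points of \<open>S\<close> cause no trouble.\<close>

lemma C1_near_has_vector_derivative_along_trajectory:
  assumes v: "C1_near S v" and x: "trajectory_on f t x0 x"
    and s: "s \<in> {0..t}" "(s, x s) \<in> S"
  shows "((\<lambda>s. v (s, x s)) has_vector_derivative Lie f v (s, x s)) (at s within {0..t})"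
proof -
  obtain L where L: "(v has_derivative L) (at (s, x s))"
    using v s(2) unfolding C1_near_def by blast
  have "((\<lambda>s. (s, x s)) has_vector_derivative (1, f s (x s))) (at s within {0..t})"
    using x s(1) unfolding trajectory_on_def
    by (intro has_vector_derivative_Pair has_vector_derivative_id) auto
  then have "(v \<circ> (\<lambda>s. (s, x s)) has_vector_derivative L (1, f s (x s))) (at s within {0..t})"
    by (rule vector_derivative_diff_chain_within) (rule has_derivative_at_withinI[OF L])
  then show ?thesis
    by (simp add: Lie_eq_derivative[OF L] o_def)
qed

lemma integrable_return:
  fixes g :: "'a \<Rightarrow> 'b::{banach, second_countable_topology}"
  assumes "x \<in> space M" and g: "g \<in> borel_measurable M"
  shows "integrable (return M x) g"
proof (rule integrableI_bounded)
  show "(\<integral>\<^sup>+ y. norm (g y) \<partial>return M x) < \<infinity>"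
    using assms by (subst nn_integral_return) auto
qed (use g in simp)

text \<open>The target carries the trace sigma-algebra on all of \<open>{0..T} \<times> X\<close>,
  not just on times up to \<open>t\<close>, so that membership in \<open>borel_measures_on\<close>
  is immediate.\<close>

definition occupation_measure ::
    "real \<Rightarrow> (real^'n) set \<Rightarrow> (real \<Rightarrow> real^'n) \<Rightarrow> real \<Rightarrow> (real \<times> (real^'n)) measure" where
  "occupation_measure T X x t =
     distr (restrict_space lborel {0..t}) (restrict_space borel ({0..T} \<times> X)) (\<lambda>s. (s, x s))"

text \<open>Change of variables. Integrability comes from compactness of \<open>{0..t}\<close>, so
  \<open>g\<close> may be unbounded on \<open>X\<close>. The indicator form is the one in which the
  fundamental theorem of calculus is applied later.\<close>

lemma occupation_measure_integral:
  assumes x: "continuous_on {0..t} x" "\<And>s. s \<in> {0..t} \<Longrightarrow> x s \<in> X" and t: "t \<in> {0..T}"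
    and g: "continuous_on ({0..T} \<times> X) (g :: real \<times> (real^'n) \<Rightarrow> real)"
  shows "integrable (occupation_measure T X x t) g"
    and "(\<integral>z. g z \<partial>occupation_measure T X x t) =
           (\<integral>s. indicator {0..t} s *\<^sub>R g (s, x s) \<partial>lborel)"
proof -
  have [measurable]: "g \<in> borel_measurable (restrict_space borel ({0..T} \<times> X))"
    using g by (rule borel_measurable_continuous_on_restrict)
  have "(\<lambda>s. (s, x s)) \<in> borel_measurable (restrict_space borel {0..t})"
    by (intro borel_measurable_continuous_on_restrict continuous_intros x)
  also have "borel_measurable (restrict_space borel {0..t})
      = borel_measurable (restrict_space lborel {0..t})"
    by (intro measurable_cong_sets sets_restrict_space_cong) auto
  finally have m [measurable]: "(\<lambda>s. (s, x s)) \<in>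
      restrict_space lborel {0..t} \<rightarrow>\<^sub>M restrict_space borel ({0..T} \<times> X)"
    by (intro measurable_restrict_space2) (use x t in \<open>auto simp: space_restrict_space\<close>)
  have "continuous_on {0..t} (\<lambda>s. g (s, x s))"
    by (rule continuous_on_compose2[OF g]) (use x t in \<open>auto intro!: continuous_intros\<close>)
  then have "set_integrable lborel {0..t} (\<lambda>s. g (s, x s))"
    by (rule borel_integrable_atLeastAtMost')
  then have "integrable (restrict_space lborel {0..t}) (\<lambda>s. g (s, x s))"
    by (simp add: integrable_restrict_space set_integrable_def)
  then show "integrable (occupation_measure T X x t) g"
    unfolding occupation_measure_def by (subst integrable_distr_eq) measurable
  show "(\<integral>z. g z \<partial>occupation_measure T X x t) =
      (\<integral>s. indicator {0..t} s *\<^sub>R g (s, x s) \<partial>lborel)"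
    unfolding occupation_measure_def
    by (subst integral_distr) (auto simp: integral_restrict_space)
qed

lemma lp_feasible_occupation_measure:
  fixes X0 X Xu :: "(real^'n) set"
  assumes "X0 \<subseteq> X"
    and f: "continuous_on ({0..T} \<times> UNIV) (\<lambda>(t, x). f t x)"
    and c: "continuous_on (X \<times> Xu) (\<lambda>(x, y). c x y)"
    and adm: "admissible T f X0 X x t" and y: "y \<in> Xu"
  shows "lp_feasible T f X0 X Xu c
           (return (restrict_space borel X0) (x 0))
           (return (restrict_space borel ({0..T} \<times> X)) (t, x t))
           (occupation_measure T X x t)
           (return (restrict_space borel (X \<times> Xu)) (x t, y))"
proof -
  have t: "t \<in> {0..T}" and xX: "\<And>s. s \<in> {0..t} \<Longrightarrow> x s \<in> X" and x0: "x 0 \<in> X0"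
    and tr: "trajectory_on f t (x 0) x"
    using adm by (auto simp: admissible_def trajectory_on_def)
  have xt: "x t \<in> X"
    using xX t by auto
  have cx: "continuous_on {0..t} x"
    using tr unfolding trajectory_on_def
    by (meson continuous_on_eq_continuous_within has_vector_derivative_continuous)
  have "liouville T f X (return (restrict_space borel X0) (x 0))
      (return (restrict_space borel ({0..T} \<times> X)) (t, x t)) (occupation_measure T X x t)"
    unfolding liouville_def
  proof (intro allI impI)
    fix v assume v: "C1_near ({0..T} \<times> X) v"
    have cv: "continuous_on ({0..T} \<times> X) v"
      using v by (rule C1_near_continuous_on)
    have cL: "continuous_on ({0..T} \<times> X) (Lie f v)"
      using v f by (rule C1_near_continuous_on_Lie)
    \<comment> \<open>Integrals against \<open>return\<close> require measurability on the whole
      space \<open>X0\<close>, not only a value at \<open>x 0\<close>.\<close>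
    have "continuous_on X0 (\<lambda>x. v (0, x))"
      by (rule continuous_on_compose2[OF cv]) (use t assms(1) in \<open>auto intro!: continuous_intros\<close>)
    note mv = borel_measurable_continuous_on_restrict[OF cv]
      borel_measurable_continuous_on_restrict[OF this]
    have "continuous_on {0..t} (\<lambda>s. Lie f v (s, x s))"
      by (rule continuous_on_compose2[OF cL]) (use xX cx t in \<open>auto intro!: continuous_intros\<close>)
    then have "(\<integral>s. indicator {0..t} s *\<^sub>R Lie f v (s, x s) \<partial>lborel) = v (t, x t) - v (0, x 0)"
      using t xX
      by (intro integral_FTC_Icc C1_near_has_vector_derivative_along_trajectory[OF v tr]) auto
    then show "integrable (return (restrict_space borel ({0..T} \<times> X)) (t, x t)) v \<and>
        integrable (return (restrict_space borel X0) (x 0)) (\<lambda>x. v (0, x)) \<and>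
        integrable (occupation_measure T X x t) (Lie f v) \<and>
        (\<integral>z. v z \<partial>return (restrict_space borel ({0..T} \<times> X)) (t, x t)) =
        (\<integral>x. v (0, x) \<partial>return (restrict_space borel X0) (x 0)) +
        (\<integral>z. Lie f v z \<partial>occupation_measure T X x t)"
      using t xt x0 mv occupation_measure_integral[OF cx xX t cL]
      by (auto intro!: integrable_return simp: integral_return space_restrict_space)
  qed
  moreover have "integrable (return (restrict_space borel (X \<times> Xu)) (x t, y)) (\<lambda>(x, y). c x y)"
    using xt y
    by (intro integrable_return borel_measurable_continuous_on_restrict c)
       (auto simp: space_restrict_space)
  \<comment> \<open>Both marginals are the Dirac measure at \<open>x t\<close>.\<close>
  moreover have "distr (return (restrict_space borel (X \<times> Xu)) (x t, y)) (restrict_space borel X) fst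
      = distr (return (restrict_space borel ({0..T} \<times> X)) (t, x t)) (restrict_space borel X) snd"
    using t xt y
    by (subst (1 2) distr_return)
       (auto simp: space_restrict_space
         intro!: measurable_restrict_space3 borel_measurable_continuous_onI continuous_intros)
  moreover have "(\<integral>\<^sup>+x. 1 \<partial>return (restrict_space borel X0) (x 0)) = 1"
    using x0 by (subst nn_integral_return) (auto simp: space_restrict_space)
  ultimately show ?thesis
    by (simp add: lp_feasible_def borel_measures_on_def occupation_measure_def)
qed

theorem theorem3p1:
  fixes X0 X Xu :: "(real^'n) set"
    and T :: real
    and f :: "real \<Rightarrow> real^'n \<Rightarrow> real^'n"
    and c :: "real^'n \<Rightarrow> real^'n \<Rightarrow> real"
  assumes "X0 \<in> sets borel" and "X \<in> sets borel" and "Xu \<in> sets borel"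
    and "X0 \<subseteq> X" and "Xu \<subseteq> X"
    and "0 < T"
    and "continuous_on ({0..T} \<times> UNIV) (\<lambda>(t, x). f t x)"
    and "continuous_on (X \<times> Xu) (\<lambda>(x, y). c x y)"
    and "compact X0 \<and> compact X \<longrightarrow> non_return T f X0 X"
  shows "lp_value T f X0 X Xu c \<le> closest_approach T f X0 X Xu c"
  unfolding closest_approach_def
proof (rule Inf_greatest, clarify)
  fix x t y
  assume adm: "admissible T f X0 X x t" and y: "y \<in> Xu"
  \<comment> \<open>This places \<open>(x t, y)\<close> in the underlying space; otherwise
    \<open>return\<close> would be the null measure.\<close>
  have "x t \<in> X"
    using adm by (auto simp: admissible_def)
  then have "(\<integral>(x, y). c x y \<partial>return (restrict_space borel (X \<times> Xu)) (x t, y)) = c (x t) y"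
    using y borel_measurable_continuous_on_restrict[OF assms(8)]
    by (subst integral_return) (auto simp: space_restrict_space)
  with lp_feasible_occupation_measure[OF assms(4,7,8) adm y]
  show "lp_value T f X0 X Xu c \<le> ereal (c (x t) y)"
    unfolding lp_value_def by (intro Inf_lower CollectI exI conjI) auto
qed

end
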